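(* Let $\Omega$ be a compact metric space, $T:\Omega\to\Omega$ a continuous map and $\nu$ a $T$-invariant probability measure on $\Omega$. Let $(\varphi_n)_{n\ge1}$ be a sequence of real valued continuous functions on $\Omega$, and let $\omega\in\Omega$. Suppose that (i) the limit $\Lambda:=\lim_{n\to\infty}\frac1n\int_\Omega\varphi_n\,d\nu$ exists and $\Lambda\in\mathbb{R}$; (ii) $\omega$ is $\nu$-generic; (iii) $(\varphi_n)$ is quasi-additive on the orbit of $\omega$, i.e. there exists a sequence of positive numbers $c_n>0$ with $c_n=o(n)$ such that for all integers $n\ge1$, $m\ge1$ and all points $x\in\{T^k\omega:k\ge0\}$, $$\varphi_n(x)+\varphi_m(T^nx)-c_{n\wedge m}\le\varphi_{n+m}(x)\le\varphi_n(x)+\varphi_m(T^nx)+c_{n\wedge m}.$$ Then the limit $\lim_{n\to\infty}\frac{\varphi_n(\omega)}{n}$ exists and is equal to $\Lambda$.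
   Context: $n\wedge m$ denotes the minimum of $n$ and $m$. A point $\omega$ is $\nu$-generic if $\frac1n\sum_{k=0}^{n-1}\delta_{T^k\omega}\to\nu$ in the weak-* topology as $n\to\infty$. *)

theory Defs
  imports "HOL-Probability.Probability"
begin

text \<open>A measure \<open>\<nu>\<close> on the compact metric space \<open>\<Omega>\<close> is understood to be a Borel measure on
  \<open>\<Omega>\<close> with the subspace topology.\<close>

definition borel_prob_on :: "'a::metric_space set \<Rightarrow> 'a measure \<Rightarrow> bool" where
  "borel_prob_on \<Omega> \<nu> \<longleftrightarrow> sets \<nu> = sets (restrict_space borel \<Omega>) \<and> prob_space \<nu>"

definition invariant_measure :: "('a \<Rightarrow> 'a) \<Rightarrow> 'a measure \<Rightarrow> bool" where
  "invariant_measure T \<nu> \<longleftrightarrow>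
     T \<in> measurable \<nu> \<nu> \<and> (\<forall>A\<in>sets \<nu>. emeasure \<nu> (T -` A \<inter> space \<nu>) = emeasure \<nu> A)"

text \<open>The measure \<open>(1/n) (\<delta>\<^bsub>\<omega>\<^esub> + \<delta>\<^bsub>T \<omega>\<^esub> + \<dots>)\<close> with \<open>n\<close> summands on the measurable space of
  \<open>M\<close>; \<open>return M x\<close> is the Dirac measure at \<open>x\<close>. For \<open>n = 0\<close> it is the zero measure, which is
  irrelevant for limits.\<close>

definition empirical_measure :: "'a measure \<Rightarrow> ('a \<Rightarrow> 'a) \<Rightarrow> 'a \<Rightarrow> nat \<Rightarrow> 'a measure" where
  "empirical_measure M T \<omega> n =
     measure_of (space M) (sets M)
       (\<lambda>A. (\<Sum>k<n. emeasure (return M ((T ^^ k) \<omega>)) A) / of_nat n)"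

text \<open>The weak-* topology is the one induced by duality with the continuous functions on \<open>\<Omega>\<close>.\<close>

definition weak_star_conv_on ::
  "'a::metric_space set \<Rightarrow> (nat \<Rightarrow> 'a measure) \<Rightarrow> 'a measure \<Rightarrow> bool" where
  "weak_star_conv_on \<Omega> \<mu> \<nu> \<longleftrightarrow>
     (\<forall>f :: 'a \<Rightarrow> real. continuous_on \<Omega> f \<longrightarrow>
        (\<lambda>n. integral\<^sup>L (\<mu> n) f) \<longlonglongrightarrow> integral\<^sup>L \<nu> f)"

definition generic_point ::
  "'a::metric_space set \<Rightarrow> ('a \<Rightarrow> 'a) \<Rightarrow> 'a measure \<Rightarrow> 'a \<Rightarrow> bool" where
  "generic_point \<Omega> T \<nu> \<omega> \<longleftrightarrow> weak_star_conv_on \<Omega> (empirical_measure \<nu> T \<omega>) \<nu>"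

definition quasi_additive_on_orbit ::
  "('a \<Rightarrow> 'a) \<Rightarrow> (nat \<Rightarrow> 'a \<Rightarrow> real) \<Rightarrow> 'a \<Rightarrow> bool" where
  "quasi_additive_on_orbit T \<phi> \<omega> \<longleftrightarrow>
     (\<exists>c :: nat \<Rightarrow> real. (\<forall>n\<ge>1. c n > 0) \<and> c \<in> o(\<lambda>n. real n) \<and>
        (\<forall>n\<ge>1. \<forall>m\<ge>1. \<forall>x \<in> {(T ^^ k) \<omega> | k. True}.
           \<phi> n x + \<phi> m ((T ^^ n) x) - c (min n m) \<le> \<phi> (n + m) x \<and>
           \<phi> (n + m) x \<le> \<phi> n x + \<phi> m ((T ^^ n) x) + c (min n m)))"

text \<open>As \<^const>\<open>measure_of\<close> yields a degenerate measure when its argument is not countably additive,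
  we check that \<^const>\<open>empirical_measure\<close> is the intended measure.\<close>

lemma empirical_measure_eq_distr:
  assumes "n \<ge> 1" and orb: "\<And>k. (T ^^ k) \<omega> \<in> space M"
  shows "empirical_measure M T \<omega> n =
    distr (uniform_count_measure {..<n}) M (\<lambda>k. (T ^^ k) \<omega>)" (is "_ = ?D")
proof -
  have meas: "(\<lambda>k. (T ^^ k) \<omega>) \<in> measurable (uniform_count_measure {..<n}) M"
    using orb by (auto simp: measurable_def space_uniform_count_measure sets_uniform_count_measure)
  have em: "(\<Sum>k<n. emeasure (return M ((T ^^ k) \<omega>)) A) / of_nat n = emeasure ?D A"
    if A: "A \<in> sets M" for A
  proof -
    let ?B = "{k. k < n \<and> (T ^^ k) \<omega> \<in> A}"
    have "(\<Sum>k<n. emeasure (return M ((T ^^ k) \<omega>)) A) = (\<Sum>k<n. indicator A ((T ^^ k) \<omega>))"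
      using A by simp
    also have "\<dots> = (\<Sum>k\<in>?B. 1)"
      by (rule sum.mono_neutral_cong_right) auto
    finally have 1: "(\<Sum>k<n. emeasure (return M ((T ^^ k) \<omega>)) A) = of_nat (card ?B)"
      by simp
    have "emeasure ?D A = emeasure (uniform_count_measure {..<n}) ?B"
      using A meas
      by (subst emeasure_distr) (auto simp: space_uniform_count_measure intro!: arg_cong2[where f=emeasure])
    also have "\<dots> = ennreal (real (card ?B) / real n)"
      by (subst emeasure_uniform_count_measure) auto
    also have "\<dots> = of_nat (card ?B) / of_nat n"
      using \<open>n \<ge> 1\<close> by (simp add: divide_ennreal[symmetric] ennreal_of_nat_eq_real_of_nat)
    finally show ?thesis using 1 by simp
  qed
  have "empirical_measure M T \<omega> n = measure_of (space M) (sets M) (emeasure ?D)"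
    unfolding empirical_measure_def
    by (rule measure_of_eq) (use em in \<open>simp_all only: sets.space_closed sets.sigma_sets_eq\<close>)
  also have "\<dots> = ?D"
    using measure_of_of_measure[of ?D] by simp
  finally show ?thesis .
qed

lemma integral_empirical_measure:
  fixes f :: "'a \<Rightarrow> real"
  assumes "n \<ge> 1" and orb: "\<And>k. (T ^^ k) \<omega> \<in> space M" and f: "f \<in> borel_measurable M"
  shows "integral\<^sup>L (empirical_measure M T \<omega> n) f = (\<Sum>k<n. f ((T ^^ k) \<omega>)) / real n"
proof -
  have meas: "(\<lambda>k. (T ^^ k) \<omega>) \<in> measurable (uniform_count_measure {..<n}) M"
    using orb by (auto simp: measurable_def space_uniform_count_measure sets_uniform_count_measure)
  show ?thesis
    using f meas
    by (simp add: empirical_measure_eq_distr[OF assms(1,2)] integral_distr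
        lebesgue_integral_point_measure_finite uniform_count_measure_def sum_divide_distrib)
qed

end

theory Submission
  imports Defs
begin

text \<open>
  Fix \<open>m\<close> and write \<open>a n = \<phi> n \<omega>\<close>. Quasi-additivity at the point \<open>\<omega>\<close> says that
  \<open>\<phi> m (T\<^sup>k \<omega>)\<close> is the increment \<open>a (k + m) - a k\<close>, up to an error that is at most \<open>c m\<close> as soon
  as \<open>k \<ge> m\<close>. Summed over \<open>k < n\<close> these increments telescope to the \<open>m\<close> terms
  \<open>a n, \<dots>, a (n + m - 1)\<close> minus a constant, and each of these terms is \<open>a n\<close> up to a bounded error,
  because \<open>a (n + i) - a n\<close> is close to \<open>\<phi> i (T\<^sup>n \<omega>)\<close> and \<open>\<phi> i\<close> is bounded on the compact set
  \<open>\<Omega>\<close>. Hence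
  \<open>\<bar>(\<Sum>k<n. \<phi> m (T\<^sup>k \<omega>)) - m * \<phi> n \<omega>\<bar> \<le> C m + n * c m\<close>, with \<open>C m\<close> independent of \<open>n\<close>.
  Divided by \<open>n m\<close>, this compares \<open>\<phi> n \<omega> / n\<close> with \<open>1 / m\<close> times a Birkhoff average of \<open>\<phi> m\<close>,
  and that average tends to \<open>\<integral> \<phi> m d\<nu>\<close> because \<open>\<omega>\<close> is generic. All limit points of \<open>\<phi> n \<omega> / n\<close>
  are therefore within \<open>c m / m\<close> of \<open>(1 / m) \<integral> \<phi> m d\<nu>\<close>, and letting \<open>m\<close> grow leaves only \<open>\<Lambda>\<close>.

  The lemma \<open>sum_increments_near_multiple\<close> is the telescoping estimate and
  \<open>limit_of_approximate_limits\<close> the final passage to the limit in \<open>n\<close> and then in \<open>m\<close>.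
\<close>

lemma sum_shift_telescope:
  fixes a :: "nat \<Rightarrow> 'b::ab_group_add"
  shows "(\<Sum>k<n. a (k + m) - a k) = (\<Sum>i<m. a (n + i) - a i)"
proof (induction n)
  case (Suc n)
  have "(\<Sum>i<m. a (Suc n + i) - a i) - (\<Sum>i<m. a (n + i) - a i)
      = (\<Sum>i<m. a (n + Suc i) - a (n + i))"
    by (simp add: sum_subtractf)
  also have "\<dots> = a (n + m) - a n"
    using sum_lessThan_telescope[of "\<lambda>i. a (n + i)" m] by simp
  finally show ?case
    using Suc by (simp add: algebra_simps)
qed simp

text \<open>The deviations \<open>\<bar>a (k + m) - a k - s k\<bar>\<close> with \<open>k < m\<close> are unrestricted: there are only finitely
  many of them, whatever \<open>n\<close> is, so they enter the constant \<open>C\<close>.\<close>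

lemma sum_increments_near_multiple:
  fixes a s :: "nat \<Rightarrow> real"
  assumes incr: "\<And>k. k \<ge> m \<Longrightarrow> \<bar>a (k + m) - a k - s k\<bar> \<le> e"
    and bdd: "\<And>i. i < m \<Longrightarrow> \<exists>B. \<forall>n\<ge>m. \<bar>a (n + i) - a n\<bar> \<le> B"
  shows "\<exists>C. \<forall>n\<ge>m. \<bar>(\<Sum>k<n. s k) - real m * a n\<bar> \<le> C + real n * e"
proof -
  obtain B where B: "\<And>i n. i < m \<Longrightarrow> n \<ge> m \<Longrightarrow> \<bar>a (n + i) - a n\<bar> \<le> B i"
    using bdd by metis
  define d where "d k = a (k + m) - a k - s k" for k
  have e: "e \<ge> 0"
    using incr[of m] by linarith
  show ?thesis
  proof (intro exI allI impI)
    fix n assume n: "n \<ge> m"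
    have "(\<Sum>k<n. d k) + (\<Sum>k<n. s k) = (\<Sum>k<n. a (k + m) - a k)"
      by (simp add: d_def flip: sum.distrib)
    also have "\<dots> = (\<Sum>i<m. a (n + i) - a i)"
      by (rule sum_shift_telescope)
    also have "\<dots> = (\<Sum>i<m. a (n + i) - a n) + real m * a n - (\<Sum>i<m. a i)"
      by (simp add: sum_subtractf)
    finally have eq: "(\<Sum>k<n. s k) - real m * a n
        = (\<Sum>i<m. a (n + i) - a n) - (\<Sum>i<m. a i) - (\<Sum>k<n. d k)"
      by simp
    have "\<bar>\<Sum>k<n. d k\<bar> \<le> (\<Sum>k<n. \<bar>d k\<bar>)"
      by (rule sum_abs)
    also have "\<dots> = (\<Sum>k<m. \<bar>d k\<bar>) + (\<Sum>k=m..<n. \<bar>d k\<bar>)"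
      using n sum.atLeastLessThan_concat[of 0 m n "\<lambda>k. \<bar>d k\<bar>"] by (simp add: atLeast0LessThan)
    also have "(\<Sum>k=m..<n. \<bar>d k\<bar>) \<le> (\<Sum>k=m..<n. e)"
      using incr by (intro sum_mono) (simp add: d_def)
    also have "(\<Sum>k=m..<n. e) \<le> real n * e"
      using e by (simp add: mult_right_mono)
    finally have "\<bar>\<Sum>k<n. d k\<bar> \<le> (\<Sum>k<m. \<bar>d k\<bar>) + real n * e"
      by simp
    moreover have "\<bar>\<Sum>i<m. a (n + i) - a n\<bar> \<le> (\<Sum>i<m. B i)"
      using B n by (intro order_trans[OF sum_abs] sum_mono) simp
    ultimately show "\<bar>(\<Sum>k<n. s k) - real m * a n\<bar>
        \<le> ((\<Sum>i<m. B i) + \<bar>\<Sum>i<m. a i\<bar> + (\<Sum>k<m. \<bar>d k\<bar>)) + real n * e"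
      unfolding eq by linarith
  qed
qed

text \<open>The constant \<open>C\<close> may depend on \<open>m\<close> in any way, because \<open>m\<close> is chosen before \<open>n\<close> tends to
  infinity.\<close>

lemma limit_of_approximate_limits:
  fixes L :: real and x e l :: "nat \<Rightarrow> real" and y :: "nat \<Rightarrow> nat \<Rightarrow> real"
  assumes y: "\<And>m. m \<ge> 1 \<Longrightarrow> y m \<longlonglongrightarrow> l m"
    and l: "l \<longlonglongrightarrow> L"
    and e: "e \<longlonglongrightarrow> 0"
    and close: "\<And>m. m \<ge> 1 \<Longrightarrow> \<exists>C. \<forall>n\<ge>m. \<bar>x n - y m n\<bar> \<le> C / real n + e m"
  shows "x \<longlonglongrightarrow> L"
proof (rule tendstoI)
  fix \<epsilon> :: real assume \<epsilon>: "\<epsilon> > 0"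
  have "eventually (\<lambda>m. m \<ge> 1 \<and> dist (l m) L < \<epsilon>/4 \<and> dist (e m) 0 < \<epsilon>/4) sequentially"
    using \<epsilon> by (intro eventually_conj eventually_ge_at_top tendstoD[OF l] tendstoD[OF e]) simp_all
  then obtain m where m: "m \<ge> 1" "dist (l m) L < \<epsilon>/4" "dist (e m) 0 < \<epsilon>/4"
    using eventually_happens'[OF sequentially_bot] by blast
  obtain C where C: "\<And>n. n \<ge> m \<Longrightarrow> \<bar>x n - y m n\<bar> \<le> C / real n + e m"
    using close[OF m(1)] by blast
  have "eventually (\<lambda>n. dist (y m n) (l m) < \<epsilon>/4) sequentially"
    using \<epsilon> by (intro tendstoD[OF y] m) simp
  moreover have "eventually (\<lambda>n. dist (C / real n) 0 < \<epsilon>/4) sequentially"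
    using \<epsilon> by (intro tendstoD[OF lim_const_over_n]) simp
  moreover have "eventually (\<lambda>n. n \<ge> m) sequentially"
    by (rule eventually_ge_at_top)
  ultimately show "eventually (\<lambda>n. dist (x n) L < \<epsilon>) sequentially"
  proof eventually_elim
    case (elim n)
    then show ?case
      using C[of n] m unfolding dist_real_def by linarith
  qed
qed

lemma generic_point_Birkhoff_average:
  fixes f :: "'a::metric_space \<Rightarrow> real"
  assumes gen: "generic_point \<Omega> T \<nu> \<omega>" and \<nu>: "borel_prob_on \<Omega> \<nu>"
    and orb: "\<And>k. (T ^^ k) \<omega> \<in> \<Omega>" and f: "continuous_on \<Omega> f"
  shows "(\<lambda>n. (\<Sum>k<n. f ((T ^^ k) \<omega>)) / real n) \<longlonglongrightarrow> integral\<^sup>L \<nu> f"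
proof -
  have sets: "sets \<nu> = sets (restrict_space borel \<Omega>)"
    using \<nu> by (simp add: borel_prob_on_def)
  have space: "space \<nu> = \<Omega>"
    using sets_eq_imp_space_eq[OF sets] by (simp add: space_restrict_space)
  have meas: "f \<in> borel_measurable \<nu>"
    using borel_measurable_continuous_on_restrict[OF f] measurable_cong_sets[OF sets refl] by blast
  have "(\<lambda>n. integral\<^sup>L (empirical_measure \<nu> T \<omega> n) f) \<longlonglongrightarrow> integral\<^sup>L \<nu> f"
    using gen f by (simp add: generic_point_def weak_star_conv_on_def)
  moreover have "eventually (\<lambda>n. integral\<^sup>L (empirical_measure \<nu> T \<omega> n) f
      = (\<Sum>k<n. f ((T ^^ k) \<omega>)) / real n) sequentially"
    using eventually_ge_at_top[of 1]
    by eventually_elim (rule integral_empirical_measure, use orb space meas in auto)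
  ultimately show ?thesis
    by (rule Lim_transform_eventually)
qed

theorem theorem1p2:
  fixes \<Omega> :: "'a::metric_space set"
    and T :: "'a \<Rightarrow> 'a"
    and \<nu> :: "'a measure"
    and \<phi> :: "nat \<Rightarrow> 'a \<Rightarrow> real"
    and \<omega> :: 'a
    and \<Lambda> :: real
  assumes "compact \<Omega>"
    and "T ` \<Omega> \<subseteq> \<Omega>"
    and "continuous_on \<Omega> T"
    and "borel_prob_on \<Omega> \<nu>"
    and "invariant_measure T \<nu>"
    and "\<And>n. n \<ge> 1 \<Longrightarrow> continuous_on \<Omega> (\<phi> n)"
    and "\<omega> \<in> \<Omega>"
    and "(\<lambda>n. (1 / real n) * (\<integral>x. \<phi> n x \<partial>\<nu>)) \<longlonglongrightarrow> \<Lambda>"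
    and "generic_point \<Omega> T \<nu> \<omega>"
    and "quasi_additive_on_orbit T \<phi> \<omega>"
  shows "(\<lambda>n. \<phi> n \<omega> / real n) \<longlonglongrightarrow> \<Lambda>"
proof -
  have orb: "(T ^^ k) \<omega> \<in> \<Omega>" for k
    using assms(2,7) by (induction k) auto
  obtain c :: "nat \<Rightarrow> real" where c_small: "c \<in> o(\<lambda>n. real n)"
    and qa: "\<forall>n\<ge>1. \<forall>m\<ge>1. \<forall>x \<in> {(T ^^ k) \<omega> | k. True}.
           \<phi> n x + \<phi> m ((T ^^ n) x) - c (min n m) \<le> \<phi> (n + m) x \<and>
           \<phi> (n + m) x \<le> \<phi> n x + \<phi> m ((T ^^ n) x) + c (min n m)"
    using assms(10) unfolding quasi_additive_on_orbit_def by blast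
  have base: "\<omega> \<in> {(T ^^ k) \<omega> | k. True}"
    by (rule CollectI, rule exI[of _ 0]) simp
  have incr: "\<bar>\<phi> (k + m) \<omega> - \<phi> k \<omega> - \<phi> m ((T ^^ k) \<omega>)\<bar> \<le> c m" if "m \<ge> 1" "k \<ge> m" for m k
  proof -
    have "k \<ge> 1" "min k m = m"
      using that by auto
    then show ?thesis
      using qa[rule_format, OF \<open>k \<ge> 1\<close> \<open>m \<ge> 1\<close> base] by auto
  qed
  show ?thesis
  proof (rule limit_of_approximate_limits)
    fix m :: nat assume m: "m \<ge> 1"
    show "(\<lambda>n. (1 / real m) * ((\<Sum>k<n. \<phi> m ((T ^^ k) \<omega>)) / real n))
        \<longlonglongrightarrow> (1 / real m) * (\<integral>x. \<phi> m x \<partial>\<nu>)"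
      using generic_point_Birkhoff_average[OF assms(9,4) orb assms(6)[OF m]]
      by (rule tendsto_mult_left)
    have bdd: "\<exists>B. \<forall>n\<ge>m. \<bar>\<phi> (n + i) \<omega> - \<phi> n \<omega>\<bar> \<le> B" if "i < m" for i
      \<comment> \<open>Quasi-additivity bounds the difference only for \<open>i \<ge> 1\<close>; for \<open>i = 0\<close> it vanishes.\<close>
    proof (cases "i = 0")
      case False
      then have i: "i \<ge> 1"
        by simp
      have "bounded (\<phi> i ` \<Omega>)"
        using assms(1) assms(6)[OF i] by (intro compact_imp_bounded compact_continuous_image)
      then obtain K where "\<And>x. x \<in> \<Omega> \<Longrightarrow> \<bar>\<phi> i x\<bar> \<le> K"
        by (auto simp: bounded_iff)
      then have K: "\<bar>\<phi> i ((T ^^ n) \<omega>)\<bar> \<le> K" for n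
        using orb by blast
      have "\<bar>\<phi> (n + i) \<omega> - \<phi> n \<omega>\<bar> \<le> K + c i" if "n \<ge> m" for n
        using incr[of i n] i \<open>i < m\<close> that K[of n] by linarith
      then show ?thesis by blast
    qed auto
    have "\<exists>C. \<forall>n\<ge>m. \<bar>(\<Sum>k<n. \<phi> m ((T ^^ k) \<omega>)) - real m * \<phi> n \<omega>\<bar> \<le> C + real n * c m"
    proof (rule sum_increments_near_multiple)
      show "\<bar>\<phi> (k + m) \<omega> - \<phi> k \<omega> - \<phi> m ((T ^^ k) \<omega>)\<bar> \<le> c m" if "k \<ge> m" for k
        by (rule incr[OF m that])
    qed (rule bdd)
    then obtain C where C: "\<And>n. n \<ge> m \<Longrightarrow>
        \<bar>(\<Sum>k<n. \<phi> m ((T ^^ k) \<omega>)) - real m * \<phi> n \<omega>\<bar> \<le> C + real n * c m"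
      by auto
    have "\<bar>\<phi> n \<omega> / real n - (1 / real m) * ((\<Sum>k<n. \<phi> m ((T ^^ k) \<omega>)) / real n)\<bar>
        \<le> (C / real m) / real n + c m / real m" if n: "n \<ge> m" for n
    proof -
      let ?S = "\<Sum>k<n. \<phi> m ((T ^^ k) \<omega>)"
      have pos: "real n > 0" "real m > 0"
        using m n by auto
      have "\<phi> n \<omega> / real n - (1 / real m) * (?S / real n)
          = - ((?S - real m * \<phi> n \<omega>) / (real m * real n))"
        using pos by (simp add: field_simps)
      then have "\<bar>\<phi> n \<omega> / real n - (1 / real m) * (?S / real n)\<bar>
          = \<bar>?S - real m * \<phi> n \<omega>\<bar> / (real m * real n)"
        using pos by simp
      also have "\<dots> \<le> (C + real n * c m) / (real m * real n)"
        using C[OF n] pos by (intro divide_right_mono) auto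
      also have "\<dots> = (C / real m) / real n + c m / real m"
        using pos by (simp add: field_simps)
      finally show ?thesis .
    qed
    then show "\<exists>C. \<forall>n\<ge>m. \<bar>\<phi> n \<omega> / real n
        - (1 / real m) * ((\<Sum>k<n. \<phi> m ((T ^^ k) \<omega>)) / real n)\<bar> \<le> C / real n + c m / real m"
      by blast
  next
    show "(\<lambda>m. c m / real m) \<longlonglongrightarrow> 0"
      by (rule smalloD_tendsto[OF c_small])
  qed (rule assms(8))
qed

end
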